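(* Let $c>0$ and let $\varphi(x)=e^{-cx^2}$ be a Gaussian. If $\Lambda\subseteq\mathbb{R}$ is separated and $D^+(\Lambda)<1$, then $\Lambda$ is an interpolating set for $V^2(\varphi)$; that is, for every $a\in\ell^2(\Lambda)$ there exists $f\in V^2(\varphi)$ such that $f(\lambda)=a_\lambda$ for all $\lambda\in\Lambda$.
   Context: Shift-invariant space: $V^2(\varphi)=\{f\in L^2(\mathbb{R}): f=\sum_{k\in\mathbb{Z}}c_k\varphi(\cdot-k),\ (c_k)\in\ell^2(\mathbb{Z})\}$; its elements are continuous functions. A set $\Lambda\subseteq\mathbb{R}$ is separated if $\inf\{|\lambda-\mu|:\lambda,\mu\in\Lambda,\lambda\neq\mu\}>0$. Upper Beurling density: $D^+(\Lambda)=\limsup_{R\to\infty}\sup_{x\in\mathbb{R}}\frac{\#(\Lambda\cap[x-R,x+R])}{2R}$. *)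

theory Defs
  imports "HOL-Analysis.Analysis"
begin

text \<open>The infimum is taken in the extended reals, so that sets with at most one point
  (infimum over the empty set, \<open>\<infinity>\<close>) count as separated.\<close>

definition separated :: "real set \<Rightarrow> bool" where
  "separated \<Lambda> \<longleftrightarrow>
     (INF (l, m) \<in> {(l, m). l \<in> \<Lambda> \<and> m \<in> \<Lambda> \<and> l \<noteq> m}. ereal \<bar>l - m\<bar>) > 0"

lemma separated_iff_uniform_discrete: "separated \<Lambda> \<longleftrightarrow> uniform_discrete \<Lambda>"
proof
  assume "separated \<Lambda>"
  then obtain e where e: "0 < ereal e"
    "ereal e < (INF (l, m) \<in> {(l, m). l \<in> \<Lambda> \<and> m \<in> \<Lambda> \<and> l \<noteq> m}. ereal \<bar>l - m\<bar>)"
    unfolding separated_def using ereal_dense2 by blast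
  have "l = m" if "l \<in> \<Lambda>" "m \<in> \<Lambda>" "dist l m < e" for l m
  proof (rule ccontr)
    assume "l \<noteq> m"
    then have "ereal e < ereal \<bar>l - m\<bar>"
      using less_INF_D[OF e(2), of "(l, m)"] that by simp
    with that show False by (simp add: dist_real_def)
  qed
  with e(1) show "uniform_discrete \<Lambda>"
    unfolding uniform_discrete_def by auto
next
  assume "uniform_discrete \<Lambda>"
  then obtain e where e: "e > 0" "\<And>l m. l \<in> \<Lambda> \<Longrightarrow> m \<in> \<Lambda> \<Longrightarrow> dist l m < e \<Longrightarrow> l = m"
    unfolding uniform_discrete_def by blast
  have "ereal e \<le> (INF (l, m) \<in> {(l, m). l \<in> \<Lambda> \<and> m \<in> \<Lambda> \<and> l \<noteq> m}. ereal \<bar>l - m\<bar>)"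
  proof (rule INF_greatest, clarify)
    fix l m assume "l \<in> \<Lambda>" "m \<in> \<Lambda>" "l \<noteq> m"
    then have "e \<le> \<bar>l - m\<bar>"
      using e(2)[of l m] unfolding dist_real_def by linarith
    then show "ereal e \<le> ereal \<bar>l - m\<bar>"
      by simp
  qed
  moreover have "0 < ereal e"
    using e(1) by simp
  ultimately show "separated \<Lambda>"
    unfolding separated_def by (rule less_le_trans[rotated])
qed

text \<open>Points are counted with the counting measure, so that infinite intersections
  contribute \<open>\<infinity>\<close> (\<^const>\<open>card\<close> would give \<open>0\<close>).\<close>

definition upper_density :: "real set \<Rightarrow> ennreal" where
  "upper_density \<Lambda> =
     Limsup at_top (\<lambda>R::real. SUP x::real.
       emeasure (count_space UNIV) (\<Lambda> \<inter> {x - R..x + R}) / ennreal (2 * R))"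

definition ell2 :: "'i set \<Rightarrow> ('i \<Rightarrow> complex) set" where
  "ell2 I = {c. (\<lambda>i. (cmod (c i))\<^sup>2) summable_on I}"

definition L2_real :: "(real \<Rightarrow> complex) set" where
  "L2_real = {f \<in> borel_measurable lebesgue. integrable lebesgue (\<lambda>x. (cmod (f x))\<^sup>2)}"

text \<open>Elements of \<open>V\<^sup>2(\<phi>)\<close> are given by their continuous representatives, which makes point
  values meaningful; the series converges (unconditionally) in the norm of \<open>L\<^sup>2(\<real>)\<close>.\<close>

definition shift_invariant_space :: "(real \<Rightarrow> complex) \<Rightarrow> (real \<Rightarrow> complex) set" where
  "shift_invariant_space \<phi> =
     {f \<in> L2_real. continuous_on UNIV f \<and>
        (\<exists>c \<in> ell2 (UNIV :: int set).
          ((\<lambda>F. \<integral>\<^sup>+x. ennreal ((cmod (f x - (\<Sum>k\<in>F. c k * \<phi> (x - of_int k))))\<^sup>2) \<partial>lebesgue)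
             \<longlongrightarrow> 0) (finite_subsets_at_top UNIV))}"

definition interpolating_set :: "real set \<Rightarrow> (real \<Rightarrow> complex) set \<Rightarrow> bool" where
  "interpolating_set \<Lambda> V \<longleftrightarrow> (\<forall>a \<in> ell2 \<Lambda>. \<exists>f \<in> V. \<forall>l \<in> \<Lambda>. f l = a l)"

definition gaussian :: "real \<Rightarrow> real \<Rightarrow> complex" where
  "gaussian c x = of_real (exp (- c * x\<^sup>2))"

end

theory Submission
  imports Defs
begin

text \<open>
  With \<open>z = exp (2 c x)\<close> a series \<open>\<Sum>k. b k * exp (- c (x - k)\<^sup>2)\<close> becomes \<open>exp (- c x\<^sup>2)\<close> times the
  Laurent series \<open>\<Sum>k. b k * exp (- c k\<^sup>2) z\<^sup>k\<close>. A Lagrange function for \<open>l\<close> in a finite subset of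
  \<open>\<Lambda>\<close> is therefore obtained from the Laurent polynomial with the factors
  \<open>1 - exp (2 c ((x - l) - (m - l)))\<close> for \<open>m > l\<close> and \<open>1 - exp (2 c ((m - l) - (x - l)))\<close> for \<open>m < l\<close>.
  Separation bounds its value at \<open>l\<close> from below, and if intervals of length \<open>L\<close> contain at most
  \<open>d L + K\<close> points, the Cauchy estimate for the \<open>j\<close>-th coefficient at \<open>x - l = j\<close> gives
  \<open>exp (c d j\<^sup>2 - 2 c j\<^sup>2 + O(\<bar>j\<bar>))\<close>. After compensating the factor \<open>exp (- c j\<^sup>2)\<close> this is
  \<open>exp (- c (1 - d) j\<^sup>2 + O(\<bar>j\<bar>))\<close>, so for \<open>d < 1\<close> the coefficients decay exponentially away
  from \<open>l\<close>, uniformly in the finite subset. Schur's test yields \<open>\<ell>\<^sup>2\<close>-bounded solutions of all finite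
  subproblems, and by Tychonoff's theorem one coefficient sequence solves all of them.
\<close>

subsection \<open>Separated sets and density\<close>

text \<open>Each cell \<open>[n * \<delta>, (n + 1) * \<delta>)\<close> holds at most one point of
  \<open>G\<close>, so the cell index \<open>g\<close> is injective and the sum is dominated by a
  geometric series with ratio \<open>exp (- \<beta> * \<delta>)\<close>. The bound does not depend
  on the size of \<open>G\<close>.\<close>

lemma sum_exp_separated_nonneg_le:
  fixes G :: "real set"
  assumes "\<delta> > 0" "\<beta> > 0" "finite G" and nonneg: "\<And>u. u \<in> G \<Longrightarrow> 0 \<le> u"
    and sep: "\<And>u v. u \<in> G \<Longrightarrow> v \<in> G \<Longrightarrow> dist u v < \<delta> \<Longrightarrow> u = v"
  shows "(\<Sum>u\<in>G. exp (- \<beta> * u)) \<le> 1 / (1 - exp (- \<beta> * \<delta>))"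
proof -
  define q where "q = exp (- \<beta> * \<delta>)"
  define g where "g u = nat \<lfloor>u / \<delta>\<rfloor>" for u :: real
  have q: "0 < q" "q < 1" using assms by (auto simp: q_def)
  have g: "real (g u) * \<delta> \<le> u" "u < real (g u) * \<delta> + \<delta>" if "u \<in> G" for u
  proof -
    have "0 \<le> u / \<delta>" using nonneg[OF that] \<open>\<delta> > 0\<close> by simp
    then have "real (g u) = of_int \<lfloor>u / \<delta>\<rfloor>" by (simp add: g_def)
    then have "real (g u) \<le> u / \<delta>" "u / \<delta> < real (g u) + 1" by linarith+
    then show "real (g u) * \<delta> \<le> u" "u < real (g u) * \<delta> + \<delta>"
      using \<open>\<delta> > 0\<close> by (simp_all add: field_simps)
  qed
  have inj: "inj_on g G"
  proof (rule inj_onI)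
    fix u v assume "u \<in> G" "v \<in> G" "g u = g v"
    then have "dist u v < \<delta>" using g[of u] g[of v] by (simp add: dist_real_def abs_if)
    then show "u = v" using sep \<open>u \<in> G\<close> \<open>v \<in> G\<close> by blast
  qed
  have "(\<Sum>u\<in>G. exp (- \<beta> * u)) \<le> (\<Sum>u\<in>G. q ^ g u)"
  proof (rule sum_mono)
    fix u assume "u \<in> G"
    have "\<beta> * (real (g u) * \<delta>) \<le> \<beta> * u"
      using g(1)[OF \<open>u \<in> G\<close>] \<open>\<beta> > 0\<close> by (intro mult_left_mono) auto
    then have "exp (- \<beta> * u) \<le> exp (real (g u) * (- \<beta> * \<delta>))" by (simp add: algebra_simps)
    then show "exp (- \<beta> * u) \<le> q ^ g u" unfolding q_def exp_of_nat_mult .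
  qed
  also have "\<dots> = (\<Sum>n\<in>g ` G. q ^ n)" using inj by (simp add: sum.reindex)
  also have "\<dots> \<le> (\<Sum>n. q ^ n)"
    using q \<open>finite G\<close> by (intro sum_le_suminf) (auto intro: summable_geometric)
  also have "\<dots> = 1 / (1 - q)" using q by (simp add: suminf_geometric)
  finally show ?thesis by (simp add: q_def)
qed

text \<open>Splitting at \<open>t\<close> and reflecting the left half reduces to two one-sided
  sums, whence the factor 2.\<close>

lemma sum_exp_separated_le:
  fixes F :: "real set"
  assumes "\<delta> > 0" "\<beta> > 0" "finite F"
    and sep: "\<And>x y. x \<in> F \<Longrightarrow> y \<in> F \<Longrightarrow> dist x y < \<delta> \<Longrightarrow> x = y"
  shows "(\<Sum>x\<in>F. exp (- \<beta> * \<bar>x - t\<bar>)) \<le> 2 / (1 - exp (- \<beta> * \<delta>))"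
proof -
  let ?A = "{x \<in> F. t \<le> x}" and ?B = "{x \<in> F. \<not> t \<le> x}"
  have "(\<Sum>x\<in>F. exp (- \<beta> * \<bar>x - t\<bar>)) =
      (\<Sum>x\<in>?A. exp (- \<beta> * \<bar>x - t\<bar>)) + (\<Sum>x\<in>?B. exp (- \<beta> * \<bar>x - t\<bar>))"
    using \<open>finite F\<close> by (subst sum.union_disjoint[symmetric]) (auto intro!: sum.cong)
  also have "(\<Sum>x\<in>?A. exp (- \<beta> * \<bar>x - t\<bar>)) = (\<Sum>u\<in>(\<lambda>x. x - t) ` ?A. exp (- \<beta> * u))"
    by (subst sum.reindex) (auto simp: inj_on_def intro!: sum.cong)
  also have "\<dots> \<le> 1 / (1 - exp (- \<beta> * \<delta>))"
    using assms by (intro sum_exp_separated_nonneg_le) (auto simp: dist_real_def)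
  also have "(\<Sum>x\<in>?B. exp (- \<beta> * \<bar>x - t\<bar>)) = (\<Sum>u\<in>(\<lambda>x. t - x) ` ?B. exp (- \<beta> * u))"
    by (subst sum.reindex) (auto simp: inj_on_def intro!: sum.cong)
  also have "\<dots> \<le> 1 / (1 - exp (- \<beta> * \<delta>))"
    using assms by (intro sum_exp_separated_nonneg_le) (auto simp: dist_real_def abs_minus_commute)
  finally show ?thesis by simp
qed

text \<open>With \<open>d\<close> strictly between the density and 1, every window of large radius
  \<open>R\<close> holds fewer than \<open>2 * R * d\<close> points. A window of arbitrary length
  \<open>L\<close> is enlarged to radius \<open>L / 2 + R1\<close> about its midpoint, and the
  enlargement costs only the constant \<open>K = 2 * d * R1\<close>.\<close>

lemma upper_density_less_one_card_bound:
  assumes "upper_density \<Lambda> < 1"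
  obtains d K :: real where "0 \<le> d" "d < 1"
    "\<And>F x L. finite F \<Longrightarrow> F \<subseteq> \<Lambda> \<Longrightarrow> 0 \<le> L \<Longrightarrow> F \<subseteq> {x..x + L} \<Longrightarrow> real (card F) \<le> d * L + K"
proof -
  obtain r where r: "upper_density \<Lambda> < r" "r < 1" using assms dense by blast
  define d where "d = enn2real r"
  have rd: "r = ennreal d" using r(2) by (simp add: d_def top.not_eq_extremum less_trans)
  have "ennreal d < ennreal 1" using r(2) rd by simp
  then have d: "0 \<le> d" "d < 1" by (simp_all add: d_def ennreal_less_iff)
  have "\<forall>\<^sub>F R in at_top. (SUP x::real. emeasure (count_space UNIV) (\<Lambda> \<inter> {x - R..x + R})
      / ennreal (2 * R)) < r"
    using r(1) unfolding upper_density_def by (rule Limsup_lessD)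
  then obtain R0 where R0: "\<And>R. R0 \<le> R \<Longrightarrow> (SUP x::real. emeasure (count_space UNIV)
      (\<Lambda> \<inter> {x - R..x + R}) / ennreal (2 * R)) < r"
    by (auto simp: eventually_at_top_linorder)
  \<comment> \<open>The maximum with 1 keeps the radius positive even for
    \<open>L = 0\<close>.\<close>
  define R1 where "R1 = max R0 1"
  show ?thesis
  proof (rule that[of d "2 * d * R1"])
    fix F :: "real set" and x L :: real
    assume F: "finite F" "F \<subseteq> \<Lambda>" and L: "0 \<le> L" "F \<subseteq> {x..x + L}"
    define R where "R = L / 2 + R1"
    have R: "0 < R" "R0 \<le> R" using L(1) by (auto simp: R_def R1_def)
    have "ennreal (card F) = emeasure (count_space UNIV) F"
      using F(1) by (simp add: emeasure_count_space ennreal_of_nat_eq_real_of_nat)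
    also have "\<dots> \<le> emeasure (count_space UNIV) (\<Lambda> \<inter> {(x + L / 2) - R..(x + L / 2) + R})"
      using F(2) L(2) by (intro emeasure_mono) (force simp: R_def R1_def)+
    finally have "ennreal (card F) / ennreal (2 * R) \<le>
        emeasure (count_space UNIV) (\<Lambda> \<inter> {(x + L / 2) - R..(x + L / 2) + R}) / ennreal (2 * R)"
      by (rule divide_right_mono_ennreal)
    also have "\<dots> \<le> (SUP x::real. emeasure (count_space UNIV) (\<Lambda> \<inter> {x - R..x + R}) / ennreal (2 * R))"
      by (rule SUP_upper) simp
    also have "\<dots> < ennreal d" using R0[OF R(2)] by (simp add: rd)
    finally have "real (card F) / (2 * R) < d"
      using R(1) d(1) by (simp add: divide_ennreal ennreal_less_iff)
    then have "real (card F) < d * (2 * R)" using R(1) by (simp add: field_simps)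
    then show "real (card F) \<le> d * L + 2 * d * R1" by (simp add: R_def algebra_simps)
  qed (use d in auto)
qed

subsection \<open>Lagrange functions for finite sets\<close>

text \<open>Multiplication by \<open>1 - b * z powi s\<close> turns the coefficients
  \<open>p j\<close> into \<open>p j - b * p (j - s)\<close>; taking absolute values turns minus
  into plus, which gives a Cauchy estimate without contour integrals. The coefficients are chosen
  before \<open>z\<close>, so each of them may be estimated at its own \<open>z\<close>.\<close>

lemma laurent_product:
  fixes a :: "'i \<Rightarrow> real" and \<sigma> :: "'i \<Rightarrow> int"
  assumes "finite I" and "\<And>i. i \<in> I \<Longrightarrow> 0 \<le> a i"
  shows "\<exists>p :: int \<Rightarrow> real. \<forall>z>0.
    ((\<lambda>j. p j * z powi j) has_sum (\<Prod>i\<in>I. 1 - a i * z powi \<sigma> i)) UNIV \<and>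
    (\<forall>j. \<bar>p j\<bar> * z powi j \<le> (\<Prod>i\<in>I. 1 + a i * z powi \<sigma> i))"
  using assms
proof (induction I rule: finite_induct)
  case empty
  have "((\<lambda>j::int. (if j = 0 then 1 else 0) * z powi j) has_sum 1) UNIV" for z :: real
    by (rule has_sum_finite_neutralI[of "{0}"]) auto
  then show ?case by (intro exI[of _ "\<lambda>j. if j = 0 then 1 else 0"]) auto
next
  case (insert i I)
  have "\<And>i. i \<in> I \<Longrightarrow> 0 \<le> a i" using insert.prems by simp
  from insert.IH[OF this] obtain p where "\<forall>z>0.
      ((\<lambda>j. p j * z powi j) has_sum (\<Prod>i\<in>I. 1 - a i * z powi \<sigma> i)) UNIV \<and>
      (\<forall>j. \<bar>p j\<bar> * z powi j \<le> (\<Prod>i\<in>I. 1 + a i * z powi \<sigma> i))" ..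
  then have p: "((\<lambda>j. p j * z powi j) has_sum (\<Prod>i\<in>I. 1 - a i * z powi \<sigma> i)) UNIV"
    "\<bar>p j\<bar> * z powi j \<le> (\<Prod>i\<in>I. 1 + a i * z powi \<sigma> i)" if "0 < z" for z j
    using that by blast+
  define s where "s = \<sigma> i"
  define b where "b = a i"
  have b: "0 \<le> b" using insert.prems by (simp add: b_def)
  define p' where "p' j = p j - b * p (j - s)" for j
  show ?case
  proof (intro exI[of _ p'] allI impI conjI)
    fix z :: real assume z: "0 < z"
    let ?P = "\<Prod>i\<in>I. 1 - a i * z powi \<sigma> i" and ?Q = "\<Prod>i\<in>I. 1 + a i * z powi \<sigma> i"
    have split: "z powi j = z powi s * z powi (j - s)" for j
      using z by (simp flip: power_int_add)
    have "((\<lambda>j. p (j - s) * z powi (j - s)) has_sum ?P) UNIV"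
      using p(1)[OF z] by (subst has_sum_reindex_bij_witness[of _ "\<lambda>j. j + s" "\<lambda>j. j - s"]) auto
    then have "((\<lambda>j. p j * z powi j + (- b * z powi s) * (p (j - s) * z powi (j - s)))
        has_sum (?P + (- b * z powi s) * ?P)) UNIV"
      by (intro has_sum_add p(1)[OF z] has_sum_cmult_right)
    moreover have "p' j * z powi j = p j * z powi j + (- b * z powi s) * (p (j - s) * z powi (j - s))" for j
      using split[of j] by (simp add: p'_def algebra_simps)
    ultimately have "((\<lambda>j. p' j * z powi j) has_sum (?P + (- b * z powi s) * ?P)) UNIV"
      by (simp only:)
    then show "((\<lambda>j. p' j * z powi j) has_sum (\<Prod>i\<in>insert i I. 1 - a i * z powi \<sigma> i)) UNIV"
      using insert.hyps by (simp add: algebra_simps s_def b_def)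
    fix j
    have "\<bar>p' j\<bar> * z powi j \<le> (\<bar>p j\<bar> + b * \<bar>p (j - s)\<bar>) * z powi j"
      using z b abs_triangle_ineq4[of "p j" "b * p (j - s)"]
      by (intro mult_right_mono) (auto simp: p'_def abs_mult)
    also have "\<dots> = \<bar>p j\<bar> * z powi j + b * z powi s * (\<bar>p (j - s)\<bar> * z powi (j - s))"
      using split[of j] by (simp add: algebra_simps)
    also have "\<dots> \<le> ?Q + b * z powi s * ?Q"
      using z b by (intro add_mono mult_left_mono p(2)) auto
    finally show "\<bar>p' j\<bar> * z powi j \<le> (\<Prod>i\<in>insert i I. 1 + a i * z powi \<sigma> i)"
      using insert.hyps by (simp add: algebra_simps s_def b_def)
  qed
qed

section \<open>Elementary inequalities and bounds for products over separated sets\<close>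

lemma one_plus_exp_le: "1 + exp u \<le> exp (max u 0 + exp (- \<bar>u\<bar>))" for u :: real
proof -
  \<comment> \<open>The larger of 1 and \<open>exp u\<close> is factored out. What remains is at
    most \<open>exp (exp (- \<bar>u\<bar>))\<close>, whose exponent is summable over separated
    points.\<close>
  have *: "1 + exp (- \<bar>u\<bar>) \<le> exp (exp (- \<bar>u\<bar>))" by (rule exp_ge_add_one_self)
  show ?thesis
  proof (cases "u \<ge> 0")
    case True
    have "1 + exp u = exp u * (1 + exp (- \<bar>u\<bar>))"
      using True by (simp add: algebra_simps flip: exp_add)
    also have "\<dots> \<le> exp u * exp (exp (- \<bar>u\<bar>))" using * by (intro mult_left_mono) auto
    finally show ?thesis using True by (simp add: exp_add max_def)
  qed (use * in auto)
qed

text \<open>A discrete layer-cake bound: it replaces the excess of \<open>n\<close> over a distance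
  \<open>D\<close> by a count of radii, so that sums of such excesses over points become sums of
  cardinalities.\<close>

lemma diff_le_sum_of_bool:
  assumes "0 \<le> D"
  shows "real n - D \<le> (\<Sum>i=1..n. of_bool (D \<le> real i))"
proof (induction n)
  case (Suc n)
  have "0 \<le> (\<Sum>i=1..n. of_bool (D \<le> real i) :: real)" by (intro sum_nonneg) auto
  then show ?case using Suc by (auto simp: of_bool_def)
qed (use assms in simp)

text \<open>Completing the square; this is how linear terms are absorbed into a negative quadratic
  one.\<close>

lemma quadratic_le:
  fixes A B t :: real
  assumes "A > 0"
  shows "B * t - A * t\<^sup>2 \<le> B\<^sup>2 / (4 * A)"
proof -
  have "0 \<le> (2 * A * t - B)\<^sup>2" by simp
  also have "\<dots> = 4 * A * (B\<^sup>2 / (4 * A) - (B * t - A * t\<^sup>2))"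
    using assms by (simp add: field_simps power2_eq_square)
  finally show ?thesis using assms by (simp add: zero_le_mult_iff)
qed

text \<open>Separation keeps each \<open>x = exp (- \<beta> * \<bar>m - l\<bar>)\<close> below
  \<open>q = exp (- \<beta> * \<delta>) < 1\<close>, where \<open>1 - x\<close> is at least
  \<open>exp (- x / (1 - q))\<close>. The exponents add up to a sum already bounded by
  \<open>2 / (1 - q)\<close>, uniformly in \<open>I\<close>.\<close>

lemma prod_one_minus_exp_ge:
  fixes I :: "real set"
  assumes "\<beta> > 0" "\<delta> > 0" "finite I" "l \<notin> I"
    and sep: "\<And>x y. x \<in> insert l I \<Longrightarrow> y \<in> insert l I \<Longrightarrow> dist x y < \<delta> \<Longrightarrow> x = y"
  shows "exp (- 2 / (1 - exp (- \<beta> * \<delta>))\<^sup>2) \<le> (\<Prod>m\<in>I. 1 - exp (- \<beta> * \<bar>m - l\<bar>))"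
proof -
  define q where "q = exp (- \<beta> * \<delta>)"
  have q: "0 < q" "q < 1" using assms by (auto simp: q_def)
  have *: "exp (- x / (1 - q)) \<le> 1 - x" if "0 < x" "x \<le> q" for x
  proof -
    have x: "0 < 1 - x" using that q by simp
    have "1 / (1 - x) = 1 + x / (1 - x)" using x by (simp add: field_simps)
    also have "\<dots> \<le> 1 + x / (1 - q)" using that q by (intro add_left_mono divide_left_mono) auto
    also have "\<dots> \<le> exp (x / (1 - q))" by (rule exp_ge_add_one_self)
    finally have "1 \<le> exp (x / (1 - q)) * (1 - x)" using x by (simp add: field_simps)
    then have "exp (- x / (1 - q)) * 1 \<le> exp (- x / (1 - q)) * (exp (x / (1 - q)) * (1 - x))"
      by (intro mult_left_mono) auto
    then show ?thesis by (simp add: exp_minus field_simps)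
  qed
  have "(\<Sum>m\<in>I. exp (- \<beta> * \<bar>m - l\<bar>)) / (1 - q) \<le> (2 / (1 - q)) / (1 - q)"
    unfolding q_def using assms q
    by (intro divide_right_mono sum_exp_separated_le) (auto simp: q_def)
  then have "exp (- 2 / (1 - q)\<^sup>2) \<le> exp (\<Sum>m\<in>I. - exp (- \<beta> * \<bar>m - l\<bar>) / (1 - q))"
    by (simp add: sum_negf power2_eq_square flip: sum_divide_distrib)
  also have "\<dots> = (\<Prod>m\<in>I. exp (- exp (- \<beta> * \<bar>m - l\<bar>) / (1 - q)))"
    using \<open>finite I\<close> by (rule exp_sum)
  also have "\<dots> \<le> (\<Prod>m\<in>I. 1 - exp (- \<beta> * \<bar>m - l\<bar>))"
  proof (rule prod_mono, intro conjI)
    fix m assume "m \<in> I"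
    then have "\<delta> \<le> \<bar>m - l\<bar>"
      using sep[of m l] \<open>l \<notin> I\<close> by (force simp: dist_real_def)
    then have "exp (- \<beta> * \<bar>m - l\<bar>) \<le> q" using \<open>\<beta> > 0\<close> by (simp add: q_def)
    then show "exp (- exp (- \<beta> * \<bar>m - l\<bar>) / (1 - q)) \<le> 1 - exp (- \<beta> * \<bar>m - l\<bar>)"
      by (intro *) auto
  qed simp
  finally show ?thesis by (simp add: q_def)
qed

text \<open>Separation and density in quantitative form: a gap \<open>\<delta>\<close> and a count
  of at most \<open>d * L + K\<close> points in intervals of length \<open>L\<close>. The Lagrange
  estimates depend on \<open>\<Lambda>\<close> only through these constants.\<close>

locale sparse_points =
  fixes \<Lambda> :: "real set" and c \<delta> d K :: real
  assumes c_pos: "0 < c" and \<delta>_pos: "0 < \<delta>"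
    and sep: "x \<in> \<Lambda> \<Longrightarrow> y \<in> \<Lambda> \<Longrightarrow> dist x y < \<delta> \<Longrightarrow> x = y"
    and d: "0 \<le> d" "d < 1"
    and card_le: "finite F \<Longrightarrow> F \<subseteq> \<Lambda> \<Longrightarrow> 0 \<le> L \<Longrightarrow> F \<subseteq> {x..x + L} \<Longrightarrow>
      real (card F) \<le> d * L + K"
begin

text \<open>This is the majorant from the Laurent expansion at \<open>z = exp (2 * c * j)\<close>.
  Only points strictly between \<open>l\<close> and \<open>l + j\<close> give factors above 2, and
  the counting bound controls their total excess; all remaining contributions form an exponential
  sum around \<open>l + j\<close>, controlled by separation.\<close>

lemma prod_one_plus_exp_le:
  fixes j :: int and l :: real
  assumes "finite I" "I \<subseteq> \<Lambda>" "l \<notin> I"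
  shows "(\<Prod>m\<in>I. 1 + exp (2 * c * (of_int j * sgn (m - l) - \<bar>m - l\<bar>)))
    \<le> exp (2 / (1 - exp (- (2 * c) * \<delta>)) + c * (d * (of_int j)\<^sup>2 + (d + 2 * K) * \<bar>of_int j\<bar>))"
proof -
  define u where "u m = 2 * c * (of_int j * sgn (m - l) - \<bar>m - l\<bar>)" for m
  define n where "n = nat \<bar>j\<bar>"
  have n: "real n = \<bar>of_int j\<bar>" by (simp add: n_def)
  then have n2: "(of_int j)\<^sup>2 = (real n)\<^sup>2" by simp
  \<comment> \<open>The points on the side of \<open>l\<close> towards \<open>l + j\<close>, at
    distance at most \<open>i\<close>; they lie in an interval of length \<open>i\<close>, to which
    the counting bound applies.\<close>
  define S where "S i = {m \<in> I. 0 < of_int j * (m - l) \<and> \<bar>m - l\<bar> \<le> real i}" for i :: nat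
  have S: "real (card (S i)) \<le> d * real i + K" for i
  proof (cases "j > 0")
    case True
    then have "S i \<subseteq> {l..l + real i}" by (auto simp: S_def zero_less_mult_iff)
    then show ?thesis
      using assms by (intro card_le[where x = l]) (auto simp: S_def)
  next
    case False
    then have "S i \<subseteq> {l - real i..(l - real i) + real i}" by (auto simp: S_def zero_less_mult_iff)
    then show ?thesis
      using assms by (intro card_le[where x = "l - real i"]) (auto simp: S_def)
  qed
  have u: "max (u m) 0 \<le> 2 * c * (\<Sum>i=1..n. of_bool (m \<in> S i))" if "m \<in> I" for m
  proof (cases "0 < u m")
    case False
    then show ?thesis using c_pos by (auto simp: max_def intro!: sum_nonneg mult_nonneg_nonneg)
  next
    case True
    then have pos: "0 < of_int j * sgn (m - l) - \<bar>m - l\<bar>"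
      using c_pos by (simp add: u_def zero_less_mult_iff)
    then have j: "0 < of_int j * sgn (m - l)" by linarith
    then have "m \<noteq> l" by auto
    with j have "0 < of_int j * sgn (m - l) * \<bar>m - l\<bar>"
      by (intro mult_pos_pos[of _ "\<bar>m - l\<bar>"]) auto
    then have *: "0 < of_int j * (m - l)" by (simp add: mult.assoc sgn_mult_abs)
    have "of_int j * sgn (m - l) = real n"
      using j by (auto simp: n sgn_if split: if_splits)
    then have "of_int j * sgn (m - l) - \<bar>m - l\<bar> \<le> (\<Sum>i=1..n. of_bool (\<bar>m - l\<bar> \<le> real i))"
      using diff_le_sum_of_bool[of "\<bar>m - l\<bar>" n] by simp
    also have "\<dots> = (\<Sum>i=1..n. of_bool (m \<in> S i))"
      using * that by (intro sum.cong) (auto simp: S_def)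
    finally show ?thesis using c_pos True by (simp add: u_def max_def)
  qed
  have "(\<Sum>m\<in>I. max (u m) 0) \<le> (\<Sum>m\<in>I. 2 * c * (\<Sum>i=1..n. of_bool (m \<in> S i)))"
    by (rule sum_mono) (rule u)
  also have "\<dots> = 2 * c * (\<Sum>i=1..n. \<Sum>m\<in>I. of_bool (m \<in> S i))"
    by (subst sum.swap) (simp add: sum_distrib_left)
  also have "(\<Sum>i=1..n. \<Sum>m\<in>I. of_bool (m \<in> S i)) = (\<Sum>i=1..n. real (card (S i)))"
  proof (rule sum.cong)
    fix i
    have "{m \<in> I. m \<in> S i} = S i" by (auto simp: S_def)
    then show "(\<Sum>m\<in>I. of_bool (m \<in> S i)) = real (card (S i))"
      using assms(1) by (simp add: of_bool_def sum.If_cases Int_def)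
  qed simp
  also have "2 * c * (\<Sum>i=1..n. real (card (S i))) \<le> 2 * c * (\<Sum>i=1..n. d * real i + K)"
    using c_pos S by (intro mult_left_mono sum_mono) auto
  \<comment> \<open>The triangular sum produces \<open>d * n\<^sup>2 / 2\<close>; after
    multiplication by \<open>2 * c\<close> the leading coefficient is \<open>c * d\<close>.\<close>
  also have "(\<Sum>i=1..n. d * real i + K) = d * (real n * (real n + 1) / 2) + K * real n"
    by (induction n) (auto simp: field_simps)
  also have "2 * c * \<dots> = c * (d * (of_int j)\<^sup>2 + (d + 2 * K) * \<bar>of_int j\<bar>)"
    using n2 by (simp add: field_simps power2_eq_square flip: n)
  finally have pos_part: "(\<Sum>m\<in>I. max (u m) 0) \<le>
      c * (d * (of_int j)\<^sup>2 + (d + 2 * K) * \<bar>of_int j\<bar>)" .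
  have abs_u: "exp (- \<bar>u m\<bar>) = exp (- (2 * c) * \<bar>m - (l + of_int j)\<bar>)" if "m \<noteq> l" for m
  proof -
    \<comment> \<open>For \<open>m \<noteq> l\<close> the sign is 1 or -1 and can be pulled out of
      the absolute value.\<close>
    have "\<bar>of_int j * sgn (m - l) - \<bar>m - l\<bar>\<bar> = \<bar>m - (l + of_int j)\<bar>"
      using that by (auto simp: sgn_if abs_if)
    then show ?thesis using c_pos by (simp add: u_def abs_mult)
  qed
  have "(\<Sum>m\<in>I. exp (- \<bar>u m\<bar>)) = (\<Sum>m\<in>I. exp (- (2 * c) * \<bar>m - (l + of_int j)\<bar>))"
    using assms(3) by (intro sum.cong abs_u) auto
  also have "\<dots> \<le> 2 / (1 - exp (- (2 * c) * \<delta>))"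
    using assms c_pos \<delta>_pos by (intro sum_exp_separated_le sep) auto
  finally have abs_part: "(\<Sum>m\<in>I. exp (- \<bar>u m\<bar>)) \<le> 2 / (1 - exp (- (2 * c) * \<delta>))" .
  have "(\<Prod>m\<in>I. 1 + exp (u m)) \<le> (\<Prod>m\<in>I. exp (max (u m) 0 + exp (- \<bar>u m\<bar>)))"
    by (intro prod_mono) (auto intro: one_plus_exp_le add_nonneg_nonneg)
  also have "\<dots> = exp ((\<Sum>m\<in>I. max (u m) 0) + (\<Sum>m\<in>I. exp (- \<bar>u m\<bar>)))"
    using assms(1) by (simp add: sum.distrib flip: exp_sum)
  also have "\<dots> \<le> exp (2 / (1 - exp (- (2 * c) * \<delta>))
      + c * (d * (of_int j)\<^sup>2 + (d + 2 * K) * \<bar>of_int j\<bar>))"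
    using pos_part abs_part by simp
  finally show ?thesis by (simp add: u_def)
qed


text \<open>\<open>C\<close> is fixed before \<open>F\<close> and \<open>l\<close>, which is what
  later permits the passage to infinite sets. The coefficients even have Gaussian decay away from
  \<open>l\<close>; the exponential rate 1 is a convenient choice that suffices for Schur's
  test.\<close>

lemma lagrange_coefficients:
  obtains C where "0 < C" "\<And>F l. finite F \<Longrightarrow> F \<subseteq> \<Lambda> \<Longrightarrow> l \<in> F \<Longrightarrow>
    \<exists>p :: int \<Rightarrow> real. (\<forall>k. \<bar>p k\<bar> \<le> C * exp (- \<bar>of_int k - l\<bar>)) \<and>
      (\<forall>m\<in>F. ((\<lambda>k. p k * exp (- c * (m - of_int k)\<^sup>2)) has_sum (if m = l then 1 else 0)) UNIV)"
proof -
  define M where "M = 2 / (1 - exp (- (2 * c) * \<delta>))"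
  define N where "N = 2 / (1 - exp (- (2 * c) * \<delta>))\<^sup>2"
  \<comment> \<open>\<open>B\<close> collects the terms linear in \<open>\<bar>j\<bar>\<close>:
    \<open>c * (d + 2 * K)\<close> from the counting bound, \<open>2 * c\<close> from replacing
    \<open>l\<close> by its floor, and 1 to pay for the decay factor
    \<open>exp (- \<bar>k - l\<bar>)\<close>.\<close>
  define B where "B = c * (d + 2 * K) + 2 * c + 1"
  \<comment> \<open>\<open>M\<close> comes from the majorant, \<open>N\<close> from division by the
    value at \<open>l\<close>, \<open>c\<close> and 1 from rounding \<open>l\<close> to an integer,
    and the last term from completing the square.\<close>
  define C where "C = exp (M + N + c + 1 + B\<^sup>2 / (4 * (c * (1 - d))))"
  have "\<exists>p :: int \<Rightarrow> real. (\<forall>k. \<bar>p k\<bar> \<le> C * exp (- \<bar>of_int k - l\<bar>)) \<and>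
      (\<forall>m\<in>F. ((\<lambda>k. p k * exp (- c * (m - of_int k)\<^sup>2)) has_sum (if m = l then 1 else 0)) UNIV)"
    if F: "finite F" "F \<subseteq> \<Lambda>" "l \<in> F" for F l
  proof -
    define I where "I = F - {l}"
    have I: "finite I" "I \<subseteq> \<Lambda>" "l \<notin> I" using F by (auto simp: I_def)
    define s :: "real \<Rightarrow> int" where "s m = (if l < m then 1 else - 1)" for m
    have s: "of_int (s m) = sgn (m - l)" if "m \<in> I" for m
      using that I by (cases "m = l") (auto simp: s_def sgn_if)
    define a where "a m = exp (- 2 * c * \<bar>m - l\<bar>)" for m
    obtain p where p: "\<And>z. 0 < z \<Longrightarrow> ((\<lambda>j. p j * z powi j) has_sum (\<Prod>m\<in>I. 1 - a m * z powi s m)) UNIV"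
        "\<And>z j. 0 < z \<Longrightarrow> \<bar>p j\<bar> * z powi j \<le> (\<Prod>m\<in>I. 1 + a m * z powi s m)"
      using laurent_product[OF I(1), of a s] by (auto simp: a_def)
    have term_eq: "a m * exp (2 * c * x) powi s m = exp (2 * c * (x * sgn (m - l) - \<bar>m - l\<bar>))"
      if "m \<in> I" for m x
      by (simp add: a_def exp_power_int s[OF that] algebra_simps flip: exp_add)
    define n where "n = \<lfloor>l\<rfloor>"
    define P where "P = (\<Prod>m\<in>I. 1 - a m)"
    have "exp (- 2 / (1 - exp (- (2 * c) * \<delta>))\<^sup>2) \<le> (\<Prod>m\<in>I. 1 - exp (- (2 * c) * \<bar>m - l\<bar>))"
    proof (rule prod_one_minus_exp_ge)
      fix x y assume "x \<in> insert l I" "y \<in> insert l I" "dist x y < \<delta>"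
      then show "x = y" using I F by (intro sep) auto
    qed (use c_pos \<delta>_pos I in auto)
    then have P: "exp (- N) \<le> P" by (simp add: P_def a_def N_def)
    then have "0 < P" by (rule less_le_trans[rotated]) simp
    \<comment> \<open>The weight cancels the Gaussian factor in \<open>j\<close>:
      \<open>w j * exp (- c * (m - n - j)\<^sup>2)\<close> equals
      \<open>exp (2 * c * (m - l)) powi j\<close> times a factor free of \<open>j\<close>. Division
      by \<open>P\<close> normalises the value at \<open>l\<close> to 1, and \<open>n\<close>
      recentres the integer indices near \<open>l\<close>.\<close>
    define w where "w j = exp (c * (of_int j)\<^sup>2 + 2 * c * of_int j * (of_int n - l)
      + c * (l - of_int n)\<^sup>2) / P" for j :: int
    define r where "r k = p (k - n) * w (k - n)" for k
    show ?thesis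
    proof (intro exI[of _ r] conjI allI ballI)
      fix k
      define j where "j = k - n"
      define J where "J = \<bar>real_of_int j\<bar>"
      have l: "\<bar>of_int n - l\<bar> \<le> 1" by (simp add: n_def) linarith
      \<comment> \<open>Each coefficient is estimated at its own point \<open>x - l = j\<close>,
        where \<open>z powi j\<close> contributes \<open>exp (2 * c * j\<^sup>2)\<close>.\<close>
      have "\<bar>p j\<bar> * exp (2 * c * of_int j) powi j \<le>
          (\<Prod>m\<in>I. 1 + exp (2 * c * (of_int j * sgn (m - l) - \<bar>m - l\<bar>)))"
        using p(2)[of "exp (2 * c * of_int j)" j] by (simp add: term_eq cong: prod.cong)
      also have "\<dots> \<le> exp (M + c * (d * (of_int j)\<^sup>2 + (d + 2 * K) * J))"
        unfolding M_def J_def using I by (intro prod_one_plus_exp_le)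
      also have "exp (2 * c * of_int j) powi j = exp (2 * c * J\<^sup>2)"
        by (simp add: exp_power_int J_def power2_eq_square algebra_simps)
      finally have pj: "\<bar>p j\<bar> * exp (2 * c * J\<^sup>2) \<le> exp (M + c * (d * J\<^sup>2 + (d + 2 * K) * J))"
        by (simp add: J_def)
      have pj: "\<bar>p j\<bar> \<le> exp (M + c * (d * J\<^sup>2 + (d + 2 * K) * J) - 2 * c * J\<^sup>2)"
        using pj by (simp add: exp_diff pos_le_divide_eq)
      have "of_int j * (of_int n - l) \<le> \<bar>of_int j * (of_int n - l)\<bar>" by simp
      also have "\<dots> \<le> J * 1" unfolding abs_mult J_def using l by (intro mult_left_mono) auto
      finally have 1: "2 * c * of_int j * (of_int n - l) \<le> 2 * c * J"
        using c_pos by simp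
      have "(l - of_int n)\<^sup>2 \<le> 1" using l by (simp add: abs_square_le_1 abs_minus_commute)
      then have 2: "c * (l - of_int n)\<^sup>2 \<le> c" using c_pos by simp
      have "w j \<le> exp (c * J\<^sup>2 + 2 * c * J + c) / exp (- N)"
        unfolding w_def using 1 2 P \<open>0 < P\<close> by (intro frac_le) (auto simp: J_def)
      also have "\<dots> = exp (c * J\<^sup>2 + 2 * c * J + c + N)" by (simp flip: exp_diff)
      finally have wj: "w j \<le> exp (c * J\<^sup>2 + 2 * c * J + c + N)" .
      have "0 \<le> w j" using \<open>0 < P\<close> by (simp add: w_def)
      then have "\<bar>r k\<bar> = \<bar>p j\<bar> * w j" by (simp add: r_def j_def abs_mult)
      also have "\<dots> \<le> exp (M + c * (d * J\<^sup>2 + (d + 2 * K) * J) - 2 * c * J\<^sup>2)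
          * exp (c * J\<^sup>2 + 2 * c * J + c + N)"
        using \<open>0 \<le> w j\<close> by (intro mult_mono pj wj) auto
      \<comment> \<open>The quadratic terms add up to
        \<open>c * d - 2 * c + c = - c * (1 - d)\<close>, negative because
        \<open>d < 1\<close>.\<close>
      also have "\<dots> = exp (M + N + c + (B * J - c * (1 - d) * J\<^sup>2) - J)"
        unfolding exp_add[symmetric] by (simp add: B_def algebra_simps)
      also have "\<dots> \<le> exp (M + N + c + B\<^sup>2 / (4 * (c * (1 - d))) + (1 - \<bar>of_int k - l\<bar>))"
      proof -
        have "B * J - c * (1 - d) * J\<^sup>2 \<le> B\<^sup>2 / (4 * (c * (1 - d)))"
          using c_pos d by (intro quadratic_le) auto
        moreover have "\<bar>of_int k - l\<bar> \<le> J + 1" using l by (simp add: J_def j_def)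
        ultimately show ?thesis by simp
      qed
      also have "\<dots> = C * exp (- \<bar>of_int k - l\<bar>)"
        unfolding C_def exp_add[symmetric] by (simp add: algebra_simps)
      finally show "\<bar>r k\<bar> \<le> C * exp (- \<bar>of_int k - l\<bar>)" .
    next
      fix m assume "m \<in> F"
      define z where "z = exp (2 * c * (m - l))"
      define h where "h = exp (c * (l - of_int n)\<^sup>2 - c * (m - of_int n)\<^sup>2) / P"
      have "r (j + n) * exp (- c * (m - of_int (j + n))\<^sup>2) = p j * z powi j * h" for j
        by (simp add: r_def w_def z_def h_def exp_power_int power2_eq_square algebra_simps flip: exp_add)
      moreover have "((\<lambda>j. p j * z powi j * h) has_sum (\<Prod>i\<in>I. 1 - a i * z powi s i) * h) UNIV"
        by (intro has_sum_cmult_left p(1)) (simp add: z_def)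
      ultimately have "((\<lambda>j. r (j + n) * exp (- c * (m - of_int (j + n))\<^sup>2)) has_sum
          (\<Prod>i\<in>I. 1 - a i * z powi s i) * h) UNIV" by (simp only:)
      moreover have "(\<Prod>i\<in>I. 1 - a i * z powi s i) * h = (if m = l then 1 else 0)"
      proof (cases "m = l")
        case True
        then show ?thesis using \<open>0 < P\<close> by (simp add: z_def h_def P_def)
      next
        case False
        then have "m \<in> I" using \<open>m \<in> F\<close> by (simp add: I_def)
        \<comment> \<open>The exponent sign \<open>s m\<close> is chosen so that the factor
          belonging to \<open>m\<close> vanishes at \<open>x = m\<close>.\<close>
        moreover have "1 - a m * z powi s m = 0"
          using term_eq[OF \<open>m \<in> I\<close>, of "m - l"] by (simp add: z_def abs_sgn mult.commute)
        ultimately have "(\<Prod>i\<in>I. 1 - a i * z powi s i) = 0" using I(1) by (intro prod_zero) auto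
        then show ?thesis using False by simp
      qed
      ultimately have "((\<lambda>j. r (j + n) * exp (- c * (m - of_int (j + n))\<^sup>2)) has_sum
          (if m = l then 1 else 0)) UNIV" by (simp only:)
      then show "((\<lambda>k. r k * exp (- c * (m - of_int k)\<^sup>2)) has_sum (if m = l then 1 else 0)) UNIV"
        by (subst has_sum_reindex_bij_witness[of _ "\<lambda>j. j + n" "\<lambda>k. k - n"]) auto
    qed
  qed
  moreover have "0 < C" by (simp add: C_def)
  ultimately show ?thesis using that by blast
qed

end

subsection \<open>Gaussian series\<close>

lemma gaussian_le_exp_abs:
  fixes c x :: real
  assumes "c > 0"
  shows "exp (- c * x\<^sup>2) \<le> exp (1 / (4 * c)) * exp (- \<bar>x\<bar>)"
proof -
  have "- c * x\<^sup>2 \<le> 1 / (4 * c) + - \<bar>x\<bar>" using quadratic_le[OF assms, of 1 "\<bar>x\<bar>"] by simp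
  then show ?thesis by (simp flip: exp_add)
qed

lemma sum_exp_abs_int_le:
  assumes "finite K"
  shows "(\<Sum>k\<in>K. exp (- \<bar>x - real_of_int k\<bar>)) \<le> 2 / (1 - exp (- 1))"
proof -
  have "(\<Sum>y\<in>real_of_int ` K. exp (- 1 * \<bar>y - x\<bar>)) \<le> 2 / (1 - exp (- 1 * 1))"
  proof (rule sum_exp_separated_le)
    fix y z assume "y \<in> real_of_int ` K" "z \<in> real_of_int ` K" "dist y z < 1"
    then obtain i j where ij: "y = of_int i" "z = of_int j" "\<bar>real_of_int i - of_int j\<bar> < 1"
      by (auto simp: dist_real_def)
    from ij(3) have "i = j" by linarith
    then show "y = z" using ij by simp
  qed (use assms in auto)
  then show ?thesis by (simp add: sum.reindex inj_on_def abs_minus_commute)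
qed

lemma sum_gaussian_int_le:
  assumes "c > 0" "finite K"
  shows "(\<Sum>k\<in>K. exp (- c * (x - real_of_int k)\<^sup>2)) \<le> exp (1 / (4 * c)) * (2 / (1 - exp (- 1)))"
proof -
  have "(\<Sum>k\<in>K. exp (- c * (x - real_of_int k)\<^sup>2))
      \<le> exp (1 / (4 * c)) * (\<Sum>k\<in>K. exp (- \<bar>x - real_of_int k\<bar>))"
    unfolding sum_distrib_left by (intro sum_mono gaussian_le_exp_abs assms)
  also have "\<dots> \<le> exp (1 / (4 * c)) * (2 / (1 - exp (- 1)))"
    by (intro mult_left_mono sum_exp_abs_int_le assms) auto
  finally show ?thesis .
qed

lemma summable_on_exp_abs_int: "(\<lambda>k::int. exp (- \<bar>real_of_int k\<bar>)) summable_on UNIV"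
  using sum_exp_abs_int_le[of _ 0]
  by (intro nonneg_bdd_above_summable_on bdd_aboveI[of _ "2 / (1 - exp (- 1))"]) auto

text \<open>A summable majorant in \<open>k\<close>, uniform for \<open>x\<close> in a bounded
  interval, as the Weierstrass test requires.\<close>

lemma gaussian_shift_le:
  fixes c x R :: real
  assumes "c > 0" "\<bar>x\<bar> \<le> R"
  shows "cmod (gaussian c (x - of_int k)) \<le> exp (1 / (4 * c)) * exp R * exp (- \<bar>real_of_int k\<bar>)"
proof -
  have "exp (- \<bar>x - real_of_int k\<bar>) \<le> exp R * exp (- \<bar>real_of_int k\<bar>)"
    using assms(2) by (simp flip: exp_add)
  then have "exp (- c * (x - of_int k)\<^sup>2) \<le> exp (1 / (4 * c)) * (exp R * exp (- \<bar>real_of_int k\<bar>))"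
    using gaussian_le_exp_abs[OF assms(1), of "x - of_int k"]
    by (meson exp_ge_zero mult_left_mono order_trans)
  then show ?thesis by (simp add: gaussian_def mult.assoc)
qed

section \<open>Square-integral bounds for finite Gaussian sums\<close>

lemma nn_integral_exp_abs_le: "(\<integral>\<^sup>+x. ennreal (exp (- \<bar>x::real\<bar>)) \<partial>lborel) \<le> 2"
proof -
  have half: "(\<integral>\<^sup>+x. ennreal (exp (- x)) * indicator {0::real..} x \<partial>lborel) = 1"
  proof -
    have "((\<lambda>x::real. - exp (- x)) \<longlongrightarrow> - 0) at_top"
      by (intro tendsto_minus filterlim_compose[OF exp_at_bot] filterlim_uminus_at_bot_at_top)
    then show ?thesis
      by (subst nn_integral_FTC_atLeast[where F = "\<lambda>x. - exp (- x)" and T = 0])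
         (auto intro!: derivative_eq_intros)
  qed
  \<comment> \<open>Writing \<open>- x\<close> as \<open>0 + - 1 * x\<close> matches the affine
    substitution rule. Both indicators are 1 at 0, so pointwise only an inequality holds.\<close>
  have "(\<integral>\<^sup>+x. ennreal (exp (- \<bar>x::real\<bar>)) \<partial>lborel) \<le>
      (\<integral>\<^sup>+x. ennreal (exp (- x)) * indicator {0..} x
        + ennreal (exp (- (0 + - 1 * x))) * indicator {0..} (0 + - 1 * x) \<partial>lborel)"
    by (intro nn_integral_mono) (auto simp: indicator_def abs_if)
  also have "\<dots> = (\<integral>\<^sup>+x. ennreal (exp (- x)) * indicator {0::real..} x \<partial>lborel) +
      (\<integral>\<^sup>+x. ennreal (exp (- (0 + - 1 * x))) * indicator {0..} (0 + - 1 * x) \<partial>lborel)"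
    by (intro nn_integral_add) auto
  also have "(\<integral>\<^sup>+x. ennreal (exp (- (0 + - 1 * x))) * indicator {0..} (0 + - 1 * x) \<partial>lborel)
      = (\<integral>\<^sup>+x. ennreal (exp (- x)) * indicator {0::real..} x \<partial>lborel)"
    using nn_integral_real_affine[of "\<lambda>x. ennreal (exp (- x)) * indicator {0::real..} x" "-1" 0]
    by simp
  finally show ?thesis by (simp add: half)
qed

lemma nn_integral_gaussian_shift_le:
  fixes c t :: real
  assumes "c > 0"
  shows "(\<integral>\<^sup>+x. ennreal (exp (- c * (x - t)\<^sup>2)) \<partial>lborel) \<le> ennreal (2 * exp (1 / (4 * c)))"
proof -
  have "(\<integral>\<^sup>+x. ennreal (exp (- c * (x - t)\<^sup>2)) \<partial>lborel) = (\<integral>\<^sup>+x. ennreal (exp (- c * x\<^sup>2)) \<partial>lborel)"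
    using nn_integral_real_affine[of "\<lambda>x. ennreal (exp (- c * x\<^sup>2))" 1 "- t"] by simp
  also have "\<dots> \<le> (\<integral>\<^sup>+x. ennreal (exp (1 / (4 * c))) * ennreal (exp (- \<bar>x\<bar>)) \<partial>lborel)"
    using gaussian_le_exp_abs[OF assms]
    by (intro nn_integral_mono) (simp flip: ennreal_mult)
  also have "\<dots> = ennreal (exp (1 / (4 * c))) * (\<integral>\<^sup>+x. ennreal (exp (- \<bar>x\<bar>)) \<partial>lborel)"
    by (intro nn_integral_cmult) auto
  also have "\<dots> \<le> ennreal (exp (1 / (4 * c))) * ennreal 2"
    using nn_integral_exp_abs_le by (intro mult_left_mono) auto
  also have "\<dots> = ennreal (2 * exp (1 / (4 * c)))"
    by (subst ennreal_mult[symmetric]) (auto simp: mult.commute)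
  finally show ?thesis .
qed

text \<open>Cauchy-Schwarz after splitting the weight as
  \<open>sqrt (w i) * sqrt (w i)\<close>.\<close>

lemma sum_mult_power2_le:
  fixes a w :: "'i \<Rightarrow> real"
  assumes "\<And>i. i \<in> I \<Longrightarrow> 0 \<le> w i"
  shows "(\<Sum>i\<in>I. a i * w i)\<^sup>2 \<le> (\<Sum>i\<in>I. (a i)\<^sup>2 * w i) * (\<Sum>i\<in>I. w i)"
proof -
  have "(\<Sum>i\<in>I. a i * w i)\<^sup>2 = (\<Sum>i\<in>I. (a i * sqrt (w i)) * sqrt (w i))\<^sup>2"
    using assms by (intro arg_cong[where f = "\<lambda>x. x\<^sup>2"] sum.cong) (auto simp: mult.assoc)
  also have "\<dots> \<le> (\<Sum>i\<in>I. (a i * sqrt (w i))\<^sup>2) * (\<Sum>i\<in>I. (sqrt (w i))\<^sup>2)"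
    by (rule Cauchy_Schwarz_ineq_sum)
  also have "\<dots> = (\<Sum>i\<in>I. (a i)\<^sup>2 * w i) * (\<Sum>i\<in>I. w i)"
    using assms by (simp add: power_mult_distrib)
  finally show ?thesis .
qed

text \<open>Schur's argument with one continuous variable: weighted Cauchy-Schwarz at each
  \<open>x\<close>, where the Gaussian weights sum to at most \<open>M\<close>, followed by termwise
  integration.\<close>

lemma nn_integral_sum_gaussian_le:
  fixes b :: "int \<Rightarrow> complex"
  assumes "c > 0"
  obtains C where "0 \<le> C" "\<And>G. finite G \<Longrightarrow>
    (\<integral>\<^sup>+x. ennreal ((cmod (\<Sum>k\<in>G. b k * gaussian c (x - of_int k)))\<^sup>2) \<partial>lborel)
      \<le> ennreal (C * (\<Sum>k\<in>G. (cmod (b k))\<^sup>2))"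
proof -
  define g where "g k x = exp (- c * (x - real_of_int k)\<^sup>2)" for k x
  define M where "M = exp (1 / (4 * c)) * (2 / (1 - exp (- 1)))"
  have M: "0 \<le> M" by (simp add: M_def)
  show ?thesis
  proof (rule that[of "M * (2 * exp (1 / (4 * c)))"])
    fix G :: "int set" assume G: "finite G"
    have pw: "ennreal ((cmod (\<Sum>k\<in>G. b k * gaussian c (x - of_int k)))\<^sup>2) \<le>
        (\<Sum>k\<in>G. ennreal (M * (cmod (b k))\<^sup>2) * ennreal (g k x))" for x
    proof -
      have "cmod (\<Sum>k\<in>G. b k * gaussian c (x - of_int k)) \<le> (\<Sum>k\<in>G. cmod (b k) * g k x)"
        by (rule order_trans[OF norm_sum]) (simp add: norm_mult gaussian_def g_def)
      then have "(cmod (\<Sum>k\<in>G. b k * gaussian c (x - of_int k)))\<^sup>2 \<le> (\<Sum>k\<in>G. cmod (b k) * g k x)\<^sup>2"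
        by (rule power_mono) simp
      also have "\<dots> \<le> (\<Sum>k\<in>G. (cmod (b k))\<^sup>2 * g k x) * (\<Sum>k\<in>G. g k x)"
        by (rule sum_mult_power2_le) (simp add: g_def)
      also have "\<dots> \<le> (\<Sum>k\<in>G. (cmod (b k))\<^sup>2 * g k x) * M"
        unfolding g_def M_def
        by (intro mult_left_mono sum_gaussian_int_le assms G sum_nonneg mult_nonneg_nonneg) auto
      also have "\<dots> = (\<Sum>k\<in>G. M * (cmod (b k))\<^sup>2 * g k x)"
        by (simp add: sum_distrib_left mult_ac)
      finally have "ennreal ((cmod (\<Sum>k\<in>G. b k * gaussian c (x - of_int k)))\<^sup>2) \<le>
          ennreal (\<Sum>k\<in>G. M * (cmod (b k))\<^sup>2 * g k x)" by (rule ennreal_leI)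
      also have "\<dots> = (\<Sum>k\<in>G. ennreal (M * (cmod (b k))\<^sup>2 * g k x))"
        using M by (intro sum_ennreal[symmetric]) (auto simp: g_def)
      also have "\<dots> = (\<Sum>k\<in>G. ennreal (M * (cmod (b k))\<^sup>2) * ennreal (g k x))"
        using M by (intro sum.cong refl ennreal_mult) (auto simp: g_def)
      finally show ?thesis .
    qed
    then have "(\<integral>\<^sup>+x. ennreal ((cmod (\<Sum>k\<in>G. b k * gaussian c (x - of_int k)))\<^sup>2) \<partial>lborel)
        \<le> (\<integral>\<^sup>+x. (\<Sum>k\<in>G. ennreal (M * (cmod (b k))\<^sup>2) * ennreal (g k x)) \<partial>lborel)"
      by (intro nn_integral_mono)
    also have "\<dots> = (\<Sum>k\<in>G. ennreal (M * (cmod (b k))\<^sup>2) * (\<integral>\<^sup>+x. ennreal (g k x) \<partial>lborel))"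
      by (subst nn_integral_sum) (auto simp: g_def nn_integral_cmult)
    also have "\<dots> \<le> (\<Sum>k\<in>G. ennreal (M * (cmod (b k))\<^sup>2) * ennreal (2 * exp (1 / (4 * c))))"
      unfolding g_def by (intro sum_mono mult_left_mono nn_integral_gaussian_shift_le assms) auto
    also have "\<dots> = ennreal (M * (2 * exp (1 / (4 * c))) * (\<Sum>k\<in>G. (cmod (b k))\<^sup>2))"
    proof -
      have "(\<Sum>k\<in>G. ennreal (M * (cmod (b k))\<^sup>2) * ennreal (2 * exp (1 / (4 * c))))
          = (\<Sum>k\<in>G. ennreal (M * (2 * exp (1 / (4 * c))) * (cmod (b k))\<^sup>2))"
        using M by (intro sum.cong refl) (simp add: mult_ac flip: ennreal_mult)
      also have "\<dots> = ennreal (\<Sum>k\<in>G. M * (2 * exp (1 / (4 * c))) * (cmod (b k))\<^sup>2)"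
        using M by (intro sum_ennreal) auto
      finally show ?thesis by (simp add: sum_distrib_left)
    qed
    finally show "(\<integral>\<^sup>+x. ennreal ((cmod (\<Sum>k\<in>G. b k * gaussian c (x - of_int k)))\<^sup>2) \<partial>lborel)
        \<le> ennreal (M * (2 * exp (1 / (4 * c))) * (\<Sum>k\<in>G. (cmod (b k))\<^sup>2))" .
  qed (use M in simp)
qed


text \<open>Uniformity holds jointly in the coefficients and the point. For a fixed sequence it
  gives continuity in \<open>x\<close>; for a fixed point it gives continuity in the coefficients,
  on which the compactness argument rests.\<close>

lemma gaussian_series_uniform_limit:
  fixes c R :: real
  assumes "c > 0"
  shows "uniform_limit ({b. \<forall>k. cmod (b k) \<le> B} \<times> {- R..R})
    (\<lambda>F (b, x). \<Sum>k\<in>F. b k * gaussian c (x - of_int k))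
    (\<lambda>(b, x). \<Sum>\<^sub>\<infinity>k. b k * gaussian c (x - of_int k)) (finite_subsets_at_top (UNIV :: int set))"
proof -
  have "uniform_limit ({b. \<forall>k. cmod (b k) \<le> B} \<times> {- R..R})
    (\<lambda>F y. \<Sum>k\<in>F. fst y k * gaussian c (snd y - of_int k))
    (\<lambda>y. \<Sum>\<^sub>\<infinity>k. fst y k * gaussian c (snd y - of_int k)) (finite_subsets_at_top (UNIV :: int set))"
  proof (rule Weierstrass_m_test_general[where M = "\<lambda>k. B * (exp (1 / (4 * c)) * exp R * exp (- \<bar>of_int k\<bar>))"])
    fix k :: int and y :: "(int \<Rightarrow> complex) \<times> real"
    assume y: "y \<in> {b. \<forall>k. cmod (b k) \<le> B} \<times> {- R..R}"
    then have "cmod (fst y k) \<le> B" "\<bar>snd y\<bar> \<le> R" by auto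
    then show "cmod (fst y k * gaussian c (snd y - of_int k)) \<le>
        B * (exp (1 / (4 * c)) * exp R * exp (- \<bar>of_int k\<bar>))"
      unfolding norm_mult using order_trans[OF norm_ge_zero, of "fst y k" B]
      by (intro mult_mono gaussian_shift_le assms) auto
  qed (intro summable_on_cmult_right summable_on_exp_abs_int)
  then show ?thesis by (simp add: case_prod_unfold)
qed

lemma gaussian_series_has_sum:
  fixes c x :: real and b :: "int \<Rightarrow> complex"
  assumes "c > 0" "\<And>k. cmod (b k) \<le> B"
  shows "((\<lambda>k. b k * gaussian c (x - of_int k)) has_sum
    (\<Sum>\<^sub>\<infinity>k. b k * gaussian c (x - of_int k))) UNIV"
proof -
  have "(b, x) \<in> {b. \<forall>k. cmod (b k) \<le> B} \<times> {- \<bar>x\<bar>..\<bar>x\<bar>}"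
    using assms(2) by (auto simp: abs_if)
  from tendsto_uniform_limitI[OF gaussian_series_uniform_limit[OF assms(1)] this]
  show ?thesis by (simp add: has_sum_def)
qed

lemma gaussian_series_continuous:
  fixes c :: real and b :: "int \<Rightarrow> complex"
  assumes "c > 0" "\<And>k. cmod (b k) \<le> B"
  shows "continuous_on UNIV (\<lambda>x. \<Sum>\<^sub>\<infinity>k. b k * gaussian c (x - of_int k))"
proof -
  let ?f = "\<lambda>x. \<Sum>\<^sub>\<infinity>k. b k * gaussian c (x - of_int k)"
  have cont: "continuous_on {- R..R} ?f" for R
  proof (rule uniform_limit_theorem)
    show "uniform_limit {- R..R} (\<lambda>F x. \<Sum>k\<in>F. b k * gaussian c (x - of_int k)) ?f
        (finite_subsets_at_top UNIV)"
      using gaussian_series_uniform_limit[OF assms(1), where B = B and R = R] assms(2)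
      by (auto simp: uniform_limit_iff elim!: eventually_mono)
    show "\<forall>\<^sub>F F in finite_subsets_at_top UNIV.
        continuous_on {- R..R} (\<lambda>x. \<Sum>k\<in>F. b k * gaussian c (x - of_int k))"
      by (intro always_eventually allI) (auto simp: gaussian_def intro!: continuous_intros)
  qed simp
  show ?thesis
  proof (rule continuous_at_imp_continuous_on, rule ballI)
    fix x :: real
    have "continuous_on {- (\<bar>x\<bar> + 1)<..<\<bar>x\<bar> + 1} ?f"
      by (rule continuous_on_subset[OF cont[of "\<bar>x\<bar> + 1"]]) auto
    moreover have "x \<in> {- (\<bar>x\<bar> + 1)<..<\<bar>x\<bar> + 1}" by auto
    ultimately show "isCont ?f x" by (auto simp: continuous_on_eq_continuous_at)
  qed
qed

text \<open>Fatou's lemma works along sequences, so the net of finite subsets is replaced by a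
  cofinal sequence of sets containing \<open>F\<close>.\<close>

lemma filterlim_symmetric_int_intervals:
  "filterlim (\<lambda>n. F \<union> {- int n..int n}) (finite_subsets_at_top UNIV) sequentially" if "finite F"
  unfolding filterlim_finite_subsets_at_top
proof (intro allI impI)
  fix X :: "int set" assume X: "finite X \<and> X \<subseteq> UNIV"
  then obtain N where N: "\<And>x. x \<in> X \<Longrightarrow> nat \<bar>x\<bar> \<le> N"
    using finite_nat_set_iff_bounded_le[of "(\<lambda>x. nat \<bar>x\<bar>) ` X"] by auto
  have "X \<subseteq> {- int n..int n}" if "N \<le> n" for n
  proof
    fix x assume "x \<in> X"
    then show "x \<in> {- int n..int n}" using N[of x] that by auto
  qed
  then show "\<forall>\<^sub>F n in sequentially. finite (F \<union> {- int n..int n}) \<and> X \<subseteq> F \<union> {- int n..int n}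
      \<and> F \<union> {- int n..int n} \<subseteq> UNIV"
    using \<open>finite F\<close> by (intro eventually_sequentiallyI[of N]) auto
qed

text \<open>The remainder after \<open>F\<close> is a pointwise limit of finite sums over indices
  outside \<open>F\<close>. Fatou's lemma and the bound for finite sums estimate its squared norm by
  \<open>C\<close> times the tail of the square sum of \<open>b\<close>, which tends to 0.\<close>

lemma gaussian_series_in_shift_invariant_space:
  fixes c :: real and b :: "int \<Rightarrow> complex"
  assumes "c > 0" and b: "b \<in> ell2 UNIV"
  shows "(\<lambda>x. \<Sum>\<^sub>\<infinity>k. b k * gaussian c (x - of_int k)) \<in> shift_invariant_space (gaussian c)"
proof -
  define f where "f x = (\<Sum>\<^sub>\<infinity>k. b k * gaussian c (x - of_int k))" for x
  define S where "S F x = (\<Sum>k\<in>F. b k * gaussian c (x - of_int k))" for F x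
  define T where "T = (\<Sum>\<^sub>\<infinity>k. (cmod (b k))\<^sup>2)"
  have T: "((\<lambda>k. (cmod (b k))\<^sup>2) has_sum T) UNIV"
    using b by (simp add: ell2_def T_def)
  have le_T: "(\<Sum>k\<in>F. (cmod (b k))\<^sup>2) \<le> T" if "finite F" for F
    using finite_sum_le_has_sum[OF T that] by simp
  have bound: "cmod (b k) \<le> sqrt T" for k
    using le_T[of "{k}"] by (simp add: real_le_rsqrt)
  have f: "((\<lambda>k. b k * gaussian c (x - of_int k)) has_sum f x) UNIV" for x
    unfolding f_def using assms(1) bound by (rule gaussian_series_has_sum)
  have cont: "continuous_on UNIV f"
    unfolding f_def using assms(1) bound by (rule gaussian_series_continuous)
  have contS: "continuous_on UNIV (S F)" for F
    unfolding S_def gaussian_def by (intro continuous_intros)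
  have [measurable]: "f \<in> borel_measurable borel" "S F \<in> borel_measurable borel" for F
    using cont contS by (auto intro: borel_measurable_continuous_onI)
  obtain C where C: "0 \<le> C" "\<And>G. finite G \<Longrightarrow>
      (\<integral>\<^sup>+x. ennreal ((cmod (S G x))\<^sup>2) \<partial>lborel) \<le> ennreal (C * (\<Sum>k\<in>G. (cmod (b k))\<^sup>2))"
    using nn_integral_sum_gaussian_le[OF assms(1), of b] unfolding S_def by blast
  have main: "(\<integral>\<^sup>+x. ennreal ((cmod (f x - S F x))\<^sup>2) \<partial>lebesgue)
      \<le> ennreal (C * (T - (\<Sum>k\<in>F. (cmod (b k))\<^sup>2)))" if F: "finite F" for F
  proof -
    define G where "G n = {- int n..int n} - F" for n
    have "(\<lambda>n. S (G n) x) \<longlonglongrightarrow> f x - S F x" for x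
    proof -
      have "(\<lambda>n. S (F \<union> {- int n..int n}) x) \<longlonglongrightarrow> f x"
        using filterlim_compose[OF f[of x, unfolded has_sum_def] filterlim_symmetric_int_intervals[OF F]]
        by (simp add: S_def)
      then have "(\<lambda>n. S (F \<union> {- int n..int n}) x - S F x) \<longlonglongrightarrow> f x - S F x"
        by (intro tendsto_intros)
      moreover have "S (F \<union> {- int n..int n}) x - S F x = S (G n) x" for n
        using F by (simp add: S_def G_def Un_Diff sum_diff flip: sum_diff)
      ultimately show ?thesis by simp
    qed
    then have "(\<lambda>n. ennreal ((cmod (S (G n) x))\<^sup>2)) \<longlonglongrightarrow> ennreal ((cmod (f x - S F x))\<^sup>2)" for x
      by (intro tendsto_ennrealI tendsto_power tendsto_norm)
    then have "ennreal ((cmod (f x - S F x))\<^sup>2) = liminf (\<lambda>n. ennreal ((cmod (S (G n) x))\<^sup>2))" for x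
      by (intro lim_imp_Liminf[symmetric]) auto
    \<comment> \<open>For these Borel integrands the integrals over \<open>lebesgue\<close> and
      \<open>lborel\<close> agree.\<close>
    then have "(\<integral>\<^sup>+x. ennreal ((cmod (f x - S F x))\<^sup>2) \<partial>lebesgue)
        = (\<integral>\<^sup>+x. liminf (\<lambda>n. ennreal ((cmod (S (G n) x))\<^sup>2)) \<partial>lborel)"
      by (simp add: nn_integral_completion)
    also have "\<dots> \<le> liminf (\<lambda>n. \<integral>\<^sup>+x. ennreal ((cmod (S (G n) x))\<^sup>2) \<partial>lborel)"
      by (rule nn_integral_liminf) measurable
    also have "\<dots> \<le> limsup (\<lambda>n. \<integral>\<^sup>+x. ennreal ((cmod (S (G n) x))\<^sup>2) \<partial>lborel)"
      by (rule Liminf_le_Limsup) simp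
    also have "\<dots> \<le> ennreal (C * (T - (\<Sum>k\<in>F. (cmod (b k))\<^sup>2)))"
    proof (rule Limsup_bounded, intro always_eventually allI)
      fix n
      have G: "finite (G n)" "G n \<inter> F = {}" by (auto simp: G_def)
      then have "(\<Sum>k\<in>G n. (cmod (b k))\<^sup>2) \<le> T - (\<Sum>k\<in>F. (cmod (b k))\<^sup>2)"
        using le_T[of "G n \<union> F"] F by (simp add: sum.union_disjoint)
      then show "(\<integral>\<^sup>+x. ennreal ((cmod (S (G n) x))\<^sup>2) \<partial>lborel) \<le>
          ennreal (C * (T - (\<Sum>k\<in>F. (cmod (b k))\<^sup>2)))"
        by (intro order_trans[OF C(2)[OF G(1)]] ennreal_leI mult_left_mono C(1))
    qed
    finally show ?thesis .
  qed
  have "((\<lambda>F. ennreal (C * (T - (\<Sum>k\<in>F. (cmod (b k))\<^sup>2)))) \<longlongrightarrow> ennreal (C * (T - T)))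
      (finite_subsets_at_top UNIV)"
    by (intro tendsto_ennrealI tendsto_intros) (use T in \<open>simp add: has_sum_def\<close>)
  then have lim: "((\<lambda>F. ennreal (C * (T - (\<Sum>k\<in>F. (cmod (b k))\<^sup>2)))) \<longlongrightarrow> 0) (finite_subsets_at_top UNIV)"
    by simp
  have "((\<lambda>F. \<integral>\<^sup>+x. ennreal ((cmod (f x - S F x))\<^sup>2) \<partial>lebesgue) \<longlongrightarrow> 0) (finite_subsets_at_top UNIV)"
  proof (rule tendsto_sandwich[OF _ _ tendsto_const lim])
    show "\<forall>\<^sub>F F in finite_subsets_at_top UNIV. (\<integral>\<^sup>+x. ennreal ((cmod (f x - S F x))\<^sup>2) \<partial>lebesgue)
        \<le> ennreal (C * (T - (\<Sum>k\<in>F. (cmod (b k))\<^sup>2)))"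
      by (rule eventually_finite_subsets_at_top_weakI) (rule main)
  qed simp
  moreover have "f \<in> L2_real"
  proof -
    have "f \<in> borel_measurable lebesgue" by (rule measurable_completion) measurable
    \<comment> \<open>The case \<open>F = {}\<close> of the remainder estimate bounds
      \<open>f\<close> itself.\<close>
    moreover have "(\<integral>\<^sup>+x. ennreal ((cmod (f x))\<^sup>2) \<partial>lebesgue) < \<infinity>"
      using main[of "{}"] by (simp add: S_def le_less_trans)
    ultimately show ?thesis
      unfolding L2_real_def by (auto intro!: integrableI_bounded)
  qed
  ultimately have "f \<in> shift_invariant_space (gaussian c)"
    unfolding shift_invariant_space_def S_def using cont b by blast
  then show ?thesis by (simp add: f_def[abs_def])
qed

subsection \<open>Interpolation\<close>

text \<open>Schur's test: weighted Cauchy-Schwarz in \<open>l\<close> uses the row sums, and the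
  column sums enter after the order of summation is exchanged.\<close>

lemma schur_sum_le:
  fixes w :: "'k \<Rightarrow> 'l \<Rightarrow> real" and a :: "'l \<Rightarrow> real"
  assumes "\<And>k l. 0 \<le> w k l" "0 \<le> M"
    and row: "\<And>k. k \<in> K \<Longrightarrow> (\<Sum>l\<in>F. w k l) \<le> M"
    and col: "\<And>l. l \<in> F \<Longrightarrow> (\<Sum>k\<in>K. w k l) \<le> N"
  shows "(\<Sum>k\<in>K. (\<Sum>l\<in>F. a l * w k l)\<^sup>2) \<le> M * N * (\<Sum>l\<in>F. (a l)\<^sup>2)"
proof -
  have "(\<Sum>k\<in>K. (\<Sum>l\<in>F. a l * w k l)\<^sup>2) \<le> (\<Sum>k\<in>K. (\<Sum>l\<in>F. (a l)\<^sup>2 * w k l) * M)"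
  proof (rule sum_mono)
    fix k assume "k \<in> K"
    have "(\<Sum>l\<in>F. a l * w k l)\<^sup>2 \<le> (\<Sum>l\<in>F. (a l)\<^sup>2 * w k l) * (\<Sum>l\<in>F. w k l)"
      using assms(1) by (rule sum_mult_power2_le)
    also have "\<dots> \<le> (\<Sum>l\<in>F. (a l)\<^sup>2 * w k l) * M"
      using assms(1) row[OF \<open>k \<in> K\<close>] by (intro mult_left_mono sum_nonneg mult_nonneg_nonneg) auto
    finally show "(\<Sum>l\<in>F. a l * w k l)\<^sup>2 \<le> (\<Sum>l\<in>F. (a l)\<^sup>2 * w k l) * M" .
  qed
  also have "\<dots> = M * (\<Sum>l\<in>F. (a l)\<^sup>2 * (\<Sum>k\<in>K. w k l))"
    unfolding sum_distrib_left sum_distrib_right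
    by (subst sum.swap) (simp add: mult_ac)
  also have "\<dots> \<le> M * (\<Sum>l\<in>F. (a l)\<^sup>2 * N)"
    using assms(2) col by (intro mult_left_mono sum_mono) auto
  also have "\<dots> = M * N * (\<Sum>l\<in>F. (a l)\<^sup>2)"
    by (simp add: mult_ac flip: sum_distrib_left)
  finally show ?thesis .
qed

lemma has_sum_sum_finite:
  fixes f :: "'i \<Rightarrow> 'k \<Rightarrow> 'b :: {topological_comm_monoid_add}"
  assumes "\<And>i. i \<in> I \<Longrightarrow> (f i has_sum s i) A"
  shows "((\<lambda>k. \<Sum>i\<in>I. f i k) has_sum (\<Sum>i\<in>I. s i)) A"
  using assms by (induction I rule: infinite_finite_induct) (auto intro: has_sum_add)

text \<open>Superposing the Lagrange functions with weights \<open>a l\<close> interpolates on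
  \<open>F\<close>. Schur's test for the kernel \<open>exp (- \<bar>k - l\<bar>)\<close> bounds the
  coefficients by the square sum of \<open>a\<close> over all of \<open>\<Lambda>\<close>, so
  \<open>B\<close> is the same for every \<open>F\<close>.\<close>

lemma (in sparse_points) finite_interpolation:
  fixes a :: "real \<Rightarrow> complex"
  assumes a: "a \<in> ell2 \<Lambda>"
  obtains B where "\<And>F. finite F \<Longrightarrow> F \<subseteq> \<Lambda> \<Longrightarrow>
    \<exists>b :: int \<Rightarrow> complex. (\<forall>G. finite G \<longrightarrow> (\<Sum>k\<in>G. (cmod (b k))\<^sup>2) \<le> B) \<and>
      (\<forall>m\<in>F. ((\<lambda>k. b k * gaussian c (m - of_int k)) has_sum a m) UNIV)"
proof -
  obtain C where C: "0 < C" "\<And>F l. finite F \<Longrightarrow> F \<subseteq> \<Lambda> \<Longrightarrow> l \<in> F \<Longrightarrow>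
    \<exists>p :: int \<Rightarrow> real. (\<forall>k. \<bar>p k\<bar> \<le> C * exp (- \<bar>of_int k - l\<bar>)) \<and>
      (\<forall>m\<in>F. ((\<lambda>k. p k * exp (- c * (m - of_int k)\<^sup>2)) has_sum (if m = l then 1 else 0)) UNIV)"
    by (rule lagrange_coefficients) blast
  define M where "M = 2 / (1 - exp (- 1 * \<delta>))"
  define N :: real where "N = 2 / (1 - exp (- 1))"
  define T where "T = (\<Sum>\<^sub>\<infinity>l\<in>\<Lambda>. (cmod (a l))\<^sup>2)"
  have pos: "0 \<le> M" "0 \<le> N" using \<delta>_pos by (auto simp: M_def N_def)
  show ?thesis
  proof (rule that[of "C\<^sup>2 * (M * N * T)"])
    fix F assume F: "finite F" "F \<subseteq> \<Lambda>"
    have "\<forall>l\<in>F. \<exists>p :: int \<Rightarrow> real. (\<forall>k. \<bar>p k\<bar> \<le> C * exp (- \<bar>of_int k - l\<bar>)) \<and>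
        (\<forall>m\<in>F. ((\<lambda>k. p k * exp (- c * (m - of_int k)\<^sup>2)) has_sum (if m = l then 1 else 0)) UNIV)"
      using C(2)[OF F] by blast
    from bchoice[OF this] obtain p where p:
      "\<And>l k. l \<in> F \<Longrightarrow> \<bar>p l k\<bar> \<le> C * exp (- \<bar>of_int k - l\<bar>)"
      "\<And>l m. l \<in> F \<Longrightarrow> m \<in> F \<Longrightarrow>
        ((\<lambda>k. p l k * exp (- c * (m - of_int k)\<^sup>2)) has_sum (if m = l then 1 else 0)) UNIV"
      by blast
    define b where "b k = (\<Sum>l\<in>F. a l * of_real (p l k))" for k
    show "\<exists>b :: int \<Rightarrow> complex. (\<forall>G. finite G \<longrightarrow> (\<Sum>k\<in>G. (cmod (b k))\<^sup>2) \<le> C\<^sup>2 * (M * N * T)) \<and>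
      (\<forall>m\<in>F. ((\<lambda>k. b k * gaussian c (m - of_int k)) has_sum a m) UNIV)"
    proof (intro exI[of _ b] conjI allI impI ballI)
      fix G :: "int set" assume G: "finite G"
      have "(\<Sum>k\<in>G. (cmod (b k))\<^sup>2) \<le>
          (\<Sum>k\<in>G. (C * (\<Sum>l\<in>F. cmod (a l) * exp (- \<bar>of_int k - l\<bar>)))\<^sup>2)"
      proof (intro sum_mono power_mono)
        fix k
        have "cmod (b k) \<le> (\<Sum>l\<in>F. cmod (a l) * \<bar>p l k\<bar>)"
          unfolding b_def by (rule order_trans[OF norm_sum]) (simp add: norm_mult)
        also have "\<dots> \<le> (\<Sum>l\<in>F. cmod (a l) * (C * exp (- \<bar>of_int k - l\<bar>)))"
          by (intro sum_mono mult_left_mono p) auto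
        finally show "cmod (b k) \<le> C * (\<Sum>l\<in>F. cmod (a l) * exp (- \<bar>of_int k - l\<bar>))"
          by (simp add: sum_distrib_left mult_ac)
      qed simp
      also have "\<dots> = C\<^sup>2 * (\<Sum>k\<in>G. (\<Sum>l\<in>F. cmod (a l) * exp (- \<bar>of_int k - l\<bar>))\<^sup>2)"
        by (simp add: power_mult_distrib flip: sum_distrib_left)
      also have "\<dots> \<le> C\<^sup>2 * (M * N * (\<Sum>l\<in>F. (cmod (a l))\<^sup>2))"
      \<comment> \<open>Row sums run over points of \<open>\<Lambda>\<close> and are bounded by
        separation; column sums run over integers.\<close>
      proof (intro mult_left_mono schur_sum_le)
        fix k :: int
        have "(\<Sum>l\<in>F. exp (- 1 * \<bar>l - of_int k\<bar>)) \<le> M"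
          unfolding M_def using F \<delta>_pos by (intro sum_exp_separated_le sep) auto
        then show "(\<Sum>l\<in>F. exp (- \<bar>of_int k - l\<bar>)) \<le> M" by (simp add: abs_minus_commute)
      next
        fix l
        show "(\<Sum>k\<in>G. exp (- \<bar>of_int k - l\<bar>)) \<le> N"
          using sum_exp_abs_int_le[OF G, of l] by (simp add: N_def abs_minus_commute)
      qed (use pos in auto)
      also have "\<dots> \<le> C\<^sup>2 * (M * N * T)"
        unfolding T_def using a F pos
        by (intro mult_left_mono finite_sum_le_infsum mult_nonneg_nonneg) (auto simp: ell2_def)
      finally show "(\<Sum>k\<in>G. (cmod (b k))\<^sup>2) \<le> C\<^sup>2 * (M * N * T)" .
    next
      fix m assume m: "m \<in> F"
      have "((\<lambda>k. \<Sum>l\<in>F. a l * of_real (p l k * exp (- c * (m - of_int k)\<^sup>2))) has_sum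
          (\<Sum>l\<in>F. a l * of_real (if m = l then 1 else 0))) UNIV"
        using p(2) m by (intro has_sum_sum_finite has_sum_cmult_right has_sum_of_real) auto
      also have "(\<Sum>l\<in>F. a l * of_real (if m = l then 1 else 0)) = a m"
        using F(1) m by (simp add: if_distrib sum.delta' cong: if_cong)
      finally show "((\<lambda>k. b k * gaussian c (m - of_int k)) has_sum a m) UNIV"
        by (simp add: b_def gaussian_def sum_distrib_right mult.assoc)
    qed
  qed
qed

section \<open>Compactness and passage from finite subsets to \<open>\<Lambda>\<close>\<close>

lemma compact_bounded_functions: "compact {b :: 'i \<Rightarrow> complex. \<forall>k. cmod (b k) \<le> r}"
proof -
  \<comment> \<open>Tychonoff's theorem; the topology on a function type is that of pointwise
    convergence.\<close>
  have "compactin (product_topology (\<lambda>_. euclidean) UNIV) (PiE UNIV (\<lambda>_ :: 'i. cball (0 :: complex) r))"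
    by (subst compactin_PiE) auto
  then have "compact (PiE UNIV (\<lambda>_ :: 'i. cball (0 :: complex) r))"
    by (simp add: euclidean_product_topology)
  also have "PiE UNIV (\<lambda>_ :: 'i. cball (0 :: complex) r) = {b. \<forall>k. cmod (b k) \<le> r}"
    by (auto simp: PiE_def Pi_def)
  finally show ?thesis .
qed

theorem theorem1p3:
  fixes c :: real and \<Lambda> :: "real set"
  assumes "c > 0"
    and "separated \<Lambda>"
    and "upper_density \<Lambda> < 1"
  shows "interpolating_set \<Lambda> (shift_invariant_space (gaussian c))"
  unfolding interpolating_set_def
proof
  fix a assume a: "a \<in> ell2 \<Lambda>"
  obtain \<delta> where \<delta>: "\<delta> > 0" "\<And>x y. x \<in> \<Lambda> \<Longrightarrow> y \<in> \<Lambda> \<Longrightarrow> dist x y < \<delta> \<Longrightarrow> x = y"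
    using assms(2) unfolding separated_iff_uniform_discrete uniform_discrete_def by blast
  obtain d K where d: "0 \<le> d" "d < 1" "\<And>F x L. finite F \<Longrightarrow> F \<subseteq> \<Lambda> \<Longrightarrow> 0 \<le> L \<Longrightarrow>
      F \<subseteq> {x..x + L} \<Longrightarrow> real (card F) \<le> d * L + K"
    by (rule upper_density_less_one_card_bound[OF assms(3)]) blast
  interpret sparse_points \<Lambda> c \<delta> d K
    using assms(1) \<delta> d by unfold_locales
  obtain B where B: "\<And>F. finite F \<Longrightarrow> F \<subseteq> \<Lambda> \<Longrightarrow>
      \<exists>b :: int \<Rightarrow> complex. (\<forall>G. finite G \<longrightarrow> (\<Sum>k\<in>G. (cmod (b k))\<^sup>2) \<le> B) \<and>
        (\<forall>m\<in>F. ((\<lambda>k. b k * gaussian c (m - of_int k)) has_sum a m) UNIV)"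
    by (rule finite_interpolation[OF a]) blast
  define X where "X = {b :: int \<Rightarrow> complex. \<forall>k. cmod (b k) \<le> sqrt B}"
  define Y where "Y = {b :: int \<Rightarrow> complex. \<forall>G. finite G \<longrightarrow> (\<Sum>k\<in>G. (cmod (b k))\<^sup>2) \<le> B}"
  define L where "L m b = (\<Sum>\<^sub>\<infinity>k. b k * gaussian c (m - of_int k))" for m and b :: "int \<Rightarrow> complex"
  have "Y \<subseteq> X"
  proof
    fix b assume "b \<in> Y"
    then have "(\<Sum>k\<in>{k}. (cmod (b k))\<^sup>2) \<le> B" for k unfolding Y_def by blast
    then show "b \<in> X" by (auto simp: X_def real_le_rsqrt)
  qed
  \<comment> \<open>Each condition defining \<open>Y\<close> involves finitely many coordinates, so
    the \<open>\<ell>\<^sup>2\<close> ball is closed for pointwise convergence and hence compact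
    inside \<open>X\<close>.\<close>
  have "closed Y"
    unfolding Y_def
    by (intro closed_Collect_all closed_Collect_imp closed_Collect_le open_Collect_const
        continuous_intros continuous_on_product_coordinates)
  moreover have "compact X" unfolding X_def by (rule compact_bounded_functions)
  ultimately have "compact Y" using \<open>Y \<subseteq> X\<close> compact_Int_closed[of X Y] by (simp add: Int_absorb1)
  \<comment> \<open>Each interpolation condition cuts out a closed subset of the compact set
    \<open>Y\<close>. Finitely many of them are compatible by the solutions of the finite problems,
    so the finite intersection property gives one sequence satisfying all.\<close>
  have "Y \<inter> (\<Inter>m\<in>\<Lambda>. Y \<inter> L m -` {a m}) \<noteq> {}"
  proof (rule compact_imp_fip_image)
    fix m
    \<comment> \<open>Evaluation at \<open>m\<close> depends on infinitely many coordinates, but on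
      \<open>X\<close> it is a uniform limit of finite sums.\<close>
    have "continuous_on X (L m)"
    proof (rule uniform_limit_theorem)
      show "uniform_limit X (\<lambda>F b. \<Sum>k\<in>F. b k * gaussian c (m - of_int k)) (L m)
          (finite_subsets_at_top UNIV)"
      proof (rule uniform_limitI)
        fix e :: real assume "0 < e"
        have "m \<in> {- \<bar>m\<bar>..\<bar>m\<bar>}" by (auto simp: abs_if)
        then show "\<forall>\<^sub>F F in finite_subsets_at_top UNIV.
            \<forall>b\<in>X. dist (\<Sum>k\<in>F. b k * gaussian c (m - of_int k)) (L m b) < e"
          using uniform_limitD[OF gaussian_series_uniform_limit[OF assms(1)] \<open>0 < e\<close>,
            where B1 = "sqrt B" and R1 = "\<bar>m\<bar>"]
          by (auto simp: X_def L_def elim!: eventually_mono)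
      qed
      show "\<forall>\<^sub>F F in finite_subsets_at_top UNIV.
          continuous_on X (\<lambda>b. \<Sum>k\<in>F. b k * gaussian c (m - of_int k))"
        by (intro always_eventually allI continuous_intros
            continuous_on_subset[OF continuous_on_product_coordinates]) auto
    qed simp
    then have "continuous_on Y (L m)" using \<open>Y \<subseteq> X\<close> by (rule continuous_on_subset)
    then show "closed (Y \<inter> L m -` {a m})"
      using \<open>closed Y\<close> by (rule continuous_closed_preimage) simp
  next
    fix F assume "finite F" "F \<subseteq> \<Lambda>"
    then obtain b where "\<forall>G. finite G \<longrightarrow> (\<Sum>k\<in>G. (cmod (b k))\<^sup>2) \<le> B"
      "\<forall>m\<in>F. ((\<lambda>k. b k * gaussian c (m - of_int k)) has_sum a m) UNIV" using B by blast
    then have "b \<in> Y \<inter> (\<Inter>m\<in>F. Y \<inter> L m -` {a m})"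
      by (auto simp: Y_def L_def infsumI)
    then show "Y \<inter> (\<Inter>m\<in>F. Y \<inter> L m -` {a m}) \<noteq> {}" by blast
  qed fact
  then obtain b where b: "b \<in> Y" "\<And>m. m \<in> \<Lambda> \<Longrightarrow> L m b = a m" by blast
  have "b \<in> ell2 UNIV"
    using b(1) unfolding ell2_def Y_def
    by (auto intro!: nonneg_bdd_above_summable_on bdd_aboveI[of _ B])
  then have "(\<lambda>x. L x b) \<in> shift_invariant_space (gaussian c)"
    unfolding L_def using assms(1) by (intro gaussian_series_in_shift_invariant_space)
  then show "\<exists>f\<in>shift_invariant_space (gaussian c). \<forall>l\<in>\<Lambda>. f l = a l"
    by (rule bexI[rotated]) (use b(2) in simp)
qed

end
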